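(* In the model described in the context with $N\ge2$ reports, let $N_{col}=N-1$ and let $SR(i,j)$, $i\in\{0,1\}$, $j\in\{0,\dots,N-1\}$, be a proper scoring rule (for example $SR(i,j)=\log\bar P(i\mid j)$). Then the following payments encourage honest reporting from a strategic agent who controls $N-1$ different reports: $$\tau(0,0)=\frac{SR(0,0)}{N_{col}},\qquad \tau(1,N-1)=\frac{SR(1,N-1)}{N_{col}},$$ $$\tau(0,k+1)=\frac{(k+1)\,SR(1,k)-k\,SR(0,k+1)}{N_{col}},\qquad k=0,\dots,N-2,$$ $$\tau(1,k)=\frac{(N-1-k)\,SR(0,k+1)-(N-2-k)\,SR(1,k)}{N_{col}},\qquad k=0,\dots,N-2,$$ (in particular $\tau(0,1)=SR(1,0)/N_{col}$). That is, for every $c\in\{0,\dots,N-1\}$ and every $r\in\{0,\dots,N-1\}$ with $r\ne c$, one has $V(c\mid c)>V(r\mid c)$, where $V(r\mid c)$ is the expected total payment of the strategic agent who observes $c$ signals equal to $1$ and submits $r$ positive reports, as defined in the context.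
   Context: $\Theta$ is a finite set of types with at least two elements. The prior satisfies $\Pr[\theta]>0$ for all $\theta\in\Theta$, $\sum_\theta\Pr[\theta]=1$; each type $\theta$ has a probability $p_\theta=\Pr[\text{signal }1\mid\theta]\in(0,1)$, with $p_{\theta_1}\neq p_{\theta_2}$ whenever $\theta_1\ne\theta_2$. There are $N$ reporting identities whose binary signals are, conditionally on the type $\theta$, independent and equal to $1$ with probability $p_\theta$ (and to $0$ otherwise). One strategic agent controls $N-1$ identities, observes all their $N-1$ signals before reporting, and maximizes the sum of the payments to these identities; the one remaining identity reports its signal honestly. For $c\in\{0,\dots,N-1\}$ and $i\in\{0,1\}$, $\bar P(i\mid c)$ is the probability that the honest identity observes $i$ given that exactly $c$ of the $N-1$ controlled identities observed $1$: $$\bar P(1\mid c)=\frac{\sum_\theta\Pr[\theta]\,p_\theta^{\,c+1}(1-p_\theta)^{N-1-c}}{\sum_\theta\Pr[\theta]\,p_\theta^{\,c}(1-p_\theta)^{N-1-c}},\qquad \bar P(0\mid c)=1-\bar P(1\mid c).$$ A payment scheme consists of reals $\tau(r,n)$, $r\in\{0,1\}$, $n\in\{0,\dots,N-1\}$: the amount paid to an identity that reports $r$ when exactly $n$ of the other $N-1$ identities report $1$. If the strategic agent observes $c$ signals equal to $1$ and submits exactly $r$ positive reports (reports equal to $1$) and $N-1-r$ negative reports, her expected total payment is $$V(r\mid c)=\sum_{n=0}^{1}\bar P(n\mid c)\Big(r\,\tau(1,r-1+n)+(N-1-r)\,\tau(0,r+n)\Big),$$ where terms with coefficient $0$ are read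 as $0$. A proper scoring rule here is a real-valued function $SR$ on $\{0,1\}\times\{0,\dots,N-1\}$ such that for all $c\ne r$ in $\{0,\dots,N-1\}$: $\bar P(0\mid c)SR(0,c)+\bar P(1\mid c)SR(1,c)>\bar P(0\mid c)SR(0,r)+\bar P(1\mid c)SR(1,r)$. *)

theory Defs
  imports "HOL-Probability.Product_PMF"
begin

text \<open>
  Throughout, \<open>T\<close> is the set of types, \<open>q\<close> the prior, \<open>p \<theta>\<close> the probability of signal 1 given
  type \<open>\<theta>\<close>, and \<open>N\<close> the number of reporting identities. Signals and reports are the naturals
  0 and 1.
\<close>

definition honest_prob ::
    "'a set \<Rightarrow> ('a \<Rightarrow> real) \<Rightarrow> ('a \<Rightarrow> real) \<Rightarrow> nat \<Rightarrow> nat \<Rightarrow> nat \<Rightarrow> real" where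
  "honest_prob T q p N i c =
     (let P1 = (\<Sum>\<theta>\<in>T. q \<theta> * p \<theta> ^ (c + 1) * (1 - p \<theta>) ^ (N - 1 - c)) /
               (\<Sum>\<theta>\<in>T. q \<theta> * p \<theta> ^ c * (1 - p \<theta>) ^ (N - 1 - c))
      in if i = 1 then P1 else 1 - P1)"

definition proper_scoring_rule ::
    "'a set \<Rightarrow> ('a \<Rightarrow> real) \<Rightarrow> ('a \<Rightarrow> real) \<Rightarrow> nat \<Rightarrow> (nat \<Rightarrow> nat \<Rightarrow> real) \<Rightarrow> bool" where
  "proper_scoring_rule T q p N SR \<longleftrightarrow>
     (\<forall>c\<in>{0..N - 1}. \<forall>r\<in>{0..N - 1}. c \<noteq> r \<longrightarrow>
        honest_prob T q p N 0 c * SR 0 c + honest_prob T q p N 1 c * SR 1 c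
          > honest_prob T q p N 0 c * SR 0 r + honest_prob T q p N 1 c * SR 1 r)"

text \<open>
  \<open>\<tau> r n\<close> is paid to an identity reporting \<open>r\<close> when \<open>n\<close> of the other identities report 1.
  For \<open>r = 0\<close> the truncated index \<open>r - 1 + n\<close>, and for \<open>r = N - 1\<close> the out-of-range index
  \<open>r + n = N\<close>, occur only with coefficient 0.
\<close>

definition agent_payoff ::
    "'a set \<Rightarrow> ('a \<Rightarrow> real) \<Rightarrow> ('a \<Rightarrow> real) \<Rightarrow> nat \<Rightarrow> (nat \<Rightarrow> nat \<Rightarrow> real) \<Rightarrow> nat \<Rightarrow> nat \<Rightarrow> real" where
  "agent_payoff T q p N \<tau> r c =
     (\<Sum>n\<in>{0, 1}. honest_prob T q p N n c *
        (real r * \<tau> 1 (r - 1 + n) + real (N - 1 - r) * \<tau> 0 (r + n)))"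

definition encourages_honesty ::
    "'a set \<Rightarrow> ('a \<Rightarrow> real) \<Rightarrow> ('a \<Rightarrow> real) \<Rightarrow> nat \<Rightarrow> (nat \<Rightarrow> nat \<Rightarrow> real) \<Rightarrow> bool" where
  "encourages_honesty T q p N \<tau> \<longleftrightarrow>
     (\<forall>c\<in>{0..N - 1}. \<forall>r\<in>{0..N - 1}. r \<noteq> c \<longrightarrow>
        agent_payoff T q p N \<tau> c c > agent_payoff T q p N \<tau> r c)"

text \<open>
  The remainder relates \<^const>\<open>honest_prob\<close> and \<^const>\<open>agent_payoff\<close> to the underlying model:
  a type is drawn from the prior, then the signals of identities \<open>0, \<dots>, N - 1\<close> are drawn
  independently. Identity \<open>N - 1\<close> is the honest one.
\<close>

definition signal_pmf :: "'a pmf \<Rightarrow> ('a \<Rightarrow> real) \<Rightarrow> nat \<Rightarrow> (nat \<Rightarrow> bool) pmf" where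
  "signal_pmf Q p N = bind_pmf Q (\<lambda>\<theta>. Pi_pmf {..<N} False (\<lambda>_. bernoulli_pmf (p \<theta>)))"

lemma map_Pi_pmf_honest_count:
  assumes "0 \<le> x" "x \<le> 1"
  shows "map_pmf (\<lambda>s. (s m, card {i\<in>{..<m}. s i}))
           (Pi_pmf {..<Suc m} False (\<lambda>_. bernoulli_pmf x)) =
         pair_pmf (bernoulli_pmf x) (binomial_pmf m x)"
proof -
  have *: "{i \<in> {..<m}. (s(m := y)) i} = {i \<in> {..<m}. s i}" for s :: "nat \<Rightarrow> bool" and y
    by auto
  have **: "binomial_pmf m x =
      map_pmf (\<lambda>f. card {i \<in> {..<m}. f i}) (Pi_pmf {..<m} False (\<lambda>_. bernoulli_pmf x))"
    using assms by (intro binomial_pmf_altdef') auto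
  have "Pi_pmf {..<Suc m} False (\<lambda>_. bernoulli_pmf x) =
      map_pmf (\<lambda>(y, f). f(m := y)) (pair_pmf (bernoulli_pmf x) (Pi_pmf {..<m} False (\<lambda>_. bernoulli_pmf x)))"
    unfolding lessThan_Suc by (rule Pi_pmf_insert) auto
  then have "map_pmf (\<lambda>s. (s m, card {i\<in>{..<m}. s i}))
        (Pi_pmf {..<Suc m} False (\<lambda>_. bernoulli_pmf x)) =
      map_pmf (\<lambda>z. (fst z, card {i\<in>{..<m}. snd z i}))
        (pair_pmf (bernoulli_pmf x) (Pi_pmf {..<m} False (\<lambda>_. bernoulli_pmf x)))"
    by (simp only: pmf.map_comp o_def case_prod_unfold * fun_upd_same)
  also have "\<dots> = pair_pmf (bernoulli_pmf x)
      (map_pmf (\<lambda>f. card {i\<in>{..<m}. f i}) (Pi_pmf {..<m} False (\<lambda>_. bernoulli_pmf x)))"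
    unfolding pair_map_pmf2 by (intro map_pmf_cong refl) auto
  also note **[symmetric]
  finally show ?thesis .
qed

lemma prob_honest_count:
  assumes "finite T" "set_pmf Q = T" "\<And>\<theta>. \<theta> \<in> T \<Longrightarrow> 0 \<le> p \<theta> \<and> p \<theta> \<le> 1" "N \<ge> 1"
  shows "measure_pmf.prob (signal_pmf Q p N)
           {s. (s (N - 1), card {i\<in>{..<N - 1}. s i}) = (b, c)} =
         (\<Sum>\<theta>\<in>T. pmf Q \<theta> * (pmf (bernoulli_pmf (p \<theta>)) b * pmf (binomial_pmf (N - 1) (p \<theta>)) c))"
proof -
  obtain m where N: "N = Suc m" using assms(4) by (cases N) auto
  let ?f = "\<lambda>s. (s m, card {i\<in>{..<m}. s i})"
  have "measure_pmf.prob (signal_pmf Q p N) {s. ?f s = (b, c)}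
      = pmf (map_pmf ?f (signal_pmf Q p N)) (b, c)"
    by (simp add: pmf_map vimage_def)
  also have "map_pmf ?f (signal_pmf Q p N) =
      bind_pmf Q (\<lambda>\<theta>. pair_pmf (bernoulli_pmf (p \<theta>)) (binomial_pmf m (p \<theta>)))"
    unfolding signal_pmf_def N map_bind_pmf
    by (intro bind_pmf_cong refl map_Pi_pmf_honest_count) (use assms in auto)
  also have "pmf \<dots> (b, c) =
      (\<Sum>\<theta>\<in>T. pmf Q \<theta> * (pmf (bernoulli_pmf (p \<theta>)) b * pmf (binomial_pmf m (p \<theta>)) c))"
    unfolding pmf_bind
    by (subst integral_measure_pmf[of T]) (use assms in \<open>auto simp: pmf_pair\<close>)
  finally show ?thesis by (simp add: N)
qed

lemma honest_prob_eq_cond_prob: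
  assumes "finite T" "set_pmf Q = T" "\<And>\<theta>. \<theta> \<in> T \<Longrightarrow> pmf Q \<theta> = q \<theta>"
    and "\<And>\<theta>. \<theta> \<in> T \<Longrightarrow> 0 < p \<theta> \<and> p \<theta> < 1" and "N \<ge> 1" "c \<le> N - 1"
  shows "honest_prob T q p N 1 c =
    \<P>(s in measure_pmf (signal_pmf Q p N). s (N - 1) \<bar> card {i\<in>{..<N - 1}. s i} = c)"
proof -
  let ?M = "signal_pmf Q p N" and ?k = "\<lambda>s. card {i\<in>{..<N - 1}. s i}"
  let ?E = "\<lambda>b. {s. (s (N - 1), ?k s) = (b, c)}"
  let ?B = "real ((N - 1) choose c)"
  let ?w = "\<lambda>\<theta>. p \<theta> ^ c * (1 - p \<theta>) ^ (N - 1 - c)"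
  have p: "0 \<le> p \<theta> \<and> p \<theta> \<le> 1" if "\<theta> \<in> T" for \<theta> using assms(4)[OF that] by auto
  have E: "measure_pmf.prob ?M (?E b) =
      (\<Sum>\<theta>\<in>T. pmf Q \<theta> * (pmf (bernoulli_pmf (p \<theta>)) b * pmf (binomial_pmf (N - 1) (p \<theta>)) c))" for b
    by (rule prob_honest_count) (use assms p in auto)
  have 1: "measure_pmf.prob ?M (?E True) = ?B * (\<Sum>\<theta>\<in>T. q \<theta> * p \<theta> ^ (c + 1) * (1 - p \<theta>) ^ (N - 1 - c))"
    unfolding E sum_distrib_left
    by (intro sum.cong refl) (use assms p in \<open>auto simp: pmf_binomial algebra_simps\<close>)
  have 0: "measure_pmf.prob ?M (?E False) =
      (\<Sum>\<theta>\<in>T. ?B * (q \<theta> * (1 - p \<theta>) * ?w \<theta>))"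
    unfolding E
    by (intro sum.cong refl) (use assms p in \<open>auto simp: algebra_simps\<close>)
  have "measure_pmf.prob ?M {s. ?k s = c} = measure_pmf.prob ?M (?E True \<union> ?E False)"
    by (rule arg_cong[where f = "measure_pmf.prob ?M"]) auto
  also have "\<dots> = measure_pmf.prob ?M (?E True) + measure_pmf.prob ?M (?E False)"
    by (rule measure_pmf.finite_measure_Union) auto
  also have "\<dots> = ?B * (\<Sum>\<theta>\<in>T. q \<theta> * p \<theta> ^ c * (1 - p \<theta>) ^ (N - 1 - c))"
    unfolding 1 0 sum_distrib_left sum.distrib[symmetric]
    by (intro sum.cong refl) (simp add: algebra_simps)
  finally have 2: "measure_pmf.prob ?M {s. ?k s = c} =
      ?B * (\<Sum>\<theta>\<in>T. q \<theta> * p \<theta> ^ c * (1 - p \<theta>) ^ (N - 1 - c))" .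
  have "?B \<noteq> 0" using assms(6) by simp
  with 1 2 show ?thesis
    by (simp add: cond_prob_def honest_prob_def)
qed

text \<open>
  If identity \<open>i\<close> reports \<open>b i\<close>, for \<open>i\<close> among \<open>0, \<dots>, N - 1\<close>, the sum of the payments to the
  \<open>N - 1\<close> controlled identities.
\<close>

definition controlled_payment :: "nat \<Rightarrow> (nat \<Rightarrow> nat \<Rightarrow> real) \<Rightarrow> (nat \<Rightarrow> bool) \<Rightarrow> real" where
  "controlled_payment N \<tau> b =
     (\<Sum>i<N - 1. \<tau> (of_bool (b i)) (card {j\<in>{..<N} - {i}. b j}))"

lemma controlled_payment_eq:
  assumes "N \<ge> 1" and r: "card {i\<in>{..<N - 1}. b i} = r"
  shows "controlled_payment N \<tau> b =
    real r * \<tau> 1 (r - 1 + of_bool (b (N - 1))) + real (N - 1 - r) * \<tau> 0 (r + of_bool (b (N - 1)))"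
proof -
  obtain m where N: "N = Suc m" using assms(1) by (cases N) auto
  define A where "A = {i\<in>{..<m}. b i}"
  define h where "h = (if b m then {m} else {})"
  have A: "finite A" "A \<subseteq> {..<m}" "card A = r" using r by (auto simp: A_def N)
  have "card {j\<in>{..<N} - {i}. b j} = card (A - {i}) + of_bool (b m)" if "i < m" for i
  proof -
    have "{j\<in>{..<N} - {i}. b j} = (A - {i}) \<union> h"
      using that by (auto simp: A_def h_def N less_Suc_eq)
    moreover have "card ((A - {i}) \<union> h) = card (A - {i}) + card h"
      using A by (intro card_Un_disjoint) (auto simp: h_def)
    ultimately show ?thesis by (simp add: h_def)
  qed
  then have "controlled_payment N \<tau> b =
      (\<Sum>i<m. \<tau> (of_bool (b i)) (card (A - {i}) + of_bool (b m)))"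
    by (simp add: controlled_payment_def N)
  also have "\<dots> = (\<Sum>i\<in>A. \<tau> (of_bool (b i)) (card (A - {i}) + of_bool (b m))) +
      (\<Sum>i\<in>{..<m} - A. \<tau> (of_bool (b i)) (card (A - {i}) + of_bool (b m)))"
    using A by (subst sum.subset_diff[of A]) auto
  also have "(\<Sum>i\<in>A. \<tau> (of_bool (b i)) (card (A - {i}) + of_bool (b m))) =
      (\<Sum>i\<in>A. \<tau> 1 (r - 1 + of_bool (b m)))"
    using A by (intro sum.cong refl) (auto simp: A_def)
  also have "(\<Sum>i\<in>{..<m} - A. \<tau> (of_bool (b i)) (card (A - {i}) + of_bool (b m))) =
      (\<Sum>i\<in>{..<m} - A. \<tau> 0 (r + of_bool (b m)))"
    using A by (intro sum.cong refl) (auto simp: A_def)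
  finally show ?thesis
    using A by (simp add: N card_Diff_subset)
qed

end

theory Submission
  imports Defs
begin

text \<open>
  The payments are the solution of the linear system saying that, when the honest identity reports
  \<open>n\<close>, the \<open>N - 1\<close> controlled identities together receive \<open>SR n r\<close> for \<open>r\<close> positive reports. The
  expected payoff is then the expected score of the forecast \<open>r\<close>, and properness is honesty.

  For the logarithmic rule, Gibbs' inequality reduces properness to injectivity of the posterior in
  the observed count. Passing from \<open>c\<close> to \<open>r > c\<close> observed signals multiplies the weight of a type
  by the \<open>(r - c)\<close>-th power of the odds \<open>p / (1 - p)\<close>, an increasing function of \<open>p\<close>, and such a
  reweighting strictly raises the mean of \<open>p\<close>.
\<close>

text \<open>Normalising the weights gives a convex combination. Needed twice: to evaluate
  \<open>g\<close> at the mean, and to keep posteriors strictly between 0 and 1.\<close>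

lemma weighted_mean_in_convex:
  fixes w f :: "'a \<Rightarrow> real"
  assumes "finite T" "T \<noteq> {}" "\<And>t. t \<in> T \<Longrightarrow> w t > 0"
    and "convex S" "\<And>t. t \<in> T \<Longrightarrow> f t \<in> S"
  shows "(\<Sum>t\<in>T. w t * f t) / (\<Sum>t\<in>T. w t) \<in> S"
proof -
  have pos: "(\<Sum>t\<in>T. w t) > 0"
    using assms by (intro sum_pos) auto
  have "(\<Sum>t\<in>T. (w t / (\<Sum>t\<in>T. w t)) *\<^sub>R f t) \<in> S"
    using assms pos
    by (intro convex_sum) (auto simp: sum_divide_distrib[symmetric] less_imp_le)
  then show ?thesis
    by (simp add: sum_divide_distrib)
qed

text \<open>A form of Chebyshev's sum inequality: \<open>f\<close> and \<open>g\<close> of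
  \<open>f\<close> have positive covariance. Centring both at the mean \<open>m\<close> makes every
  summand nonnegative.\<close>

lemma weighted_mean_strict_mono:
  fixes w f :: "'a \<Rightarrow> real" and g :: "real \<Rightarrow> real"
  assumes "finite T" "\<And>t. t \<in> T \<Longrightarrow> w t > 0"
    and "convex S" "\<And>t. t \<in> T \<Longrightarrow> f t \<in> S"
    and "strict_mono_on S g" "\<And>x. x \<in> S \<Longrightarrow> g x > 0"
    and "a \<in> T" "b \<in> T" "f a \<noteq> f b"
  shows "(\<Sum>t\<in>T. w t * f t) / (\<Sum>t\<in>T. w t) <
         (\<Sum>t\<in>T. w t * g (f t) * f t) / (\<Sum>t\<in>T. w t * g (f t))"
proof -
  define m where "m = (\<Sum>t\<in>T. w t * f t) / (\<Sum>t\<in>T. w t)"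
  have W: "(\<Sum>t\<in>T. w t) > 0"
    using assms by (intro sum_pos) auto
  have Wg: "(\<Sum>t\<in>T. w t * g (f t)) > 0"
    using assms by (intro sum_pos) auto
  have mS: "m \<in> S"
    unfolding m_def using assms by (intro weighted_mean_in_convex) auto
  have pos: "(f t - m) * (g (f t) - g m) > 0" if "t \<in> T" "f t \<noteq> m" for t
    using strict_mono_onD[OF assms(5), of "f t" m] strict_mono_onD[OF assms(5), of m "f t"]
      assms(4)[OF that(1)] mS that(2)
    by (cases "f t" m rule: linorder_cases) (auto simp: zero_less_mult_iff)
  \<comment> \<open>\<open>f a\<close> and \<open>f b\<close> differ, so at most one of them equals
    \<open>m\<close>; this makes the sum strictly positive.\<close>
  obtain d where d: "d \<in> T" "f d \<noteq> m"
    using assms by metis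
  have "(\<Sum>t\<in>T. w t * ((f t - m) * (g (f t) - g m))) > 0"
  proof (rule sum_pos2)
    show "w d * ((f d - m) * (g (f d) - g m)) > 0"
      using pos[OF d] assms d by simp
    show "w t * ((f t - m) * (g (f t) - g m)) \<ge> 0" if "t \<in> T" for t
      using pos[OF that] assms(2)[OF that] by (cases "f t = m") auto
  qed (use assms d in auto)
  also have "(\<Sum>t\<in>T. w t * ((f t - m) * (g (f t) - g m))) =
      (\<Sum>t\<in>T. w t * g (f t) * f t) - m * (\<Sum>t\<in>T. w t * g (f t))
      - g m * ((\<Sum>t\<in>T. w t * f t) - m * (\<Sum>t\<in>T. w t))"
    by (simp add: sum_distrib_left sum_subtractf[symmetric] algebra_simps)
  \<comment> \<open>Deviations from the mean cancel, which removes the \<open>g m\<close>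
    term.\<close>
  also have "(\<Sum>t\<in>T. w t * f t) - m * (\<Sum>t\<in>T. w t) = 0"
    using W by (simp add: m_def)
  finally have "m < (\<Sum>t\<in>T. w t * g (f t) * f t) / (\<Sum>t\<in>T. w t * g (f t))"
    using Wg by (simp add: pos_less_divide_eq)
  then show ?thesis
    by (simp only: m_def)
qed

text \<open>Add \<open>ln_less\<close> for the pairs \<open>a\<close>, \<open>b\<close> and
  \<open>1 - a\<close>, \<open>1 - b\<close>: the right-hand sides sum to 0.\<close>

lemma gibbs_binary:
  fixes a b :: real
  assumes "0 < a" "a < 1" "0 < b" "b < 1" "a \<noteq> b"
  shows "(1 - a) * ln (1 - b) + a * ln b < (1 - a) * ln (1 - a) + a * ln a"
proof -
  have ln_less: "x * ln y - x * ln x < y - x" if "0 < x" "0 < y" "x \<noteq> y" for x y :: real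
  proof -
    have "ln (y / x) < y / x - 1"
      using that ln_le_minus_one[of "y / x"] ln_eq_minus_one[of "y / x"] by force
    then have "x * ln (y / x) < x * (y / x - 1)"
      using that by simp
    then show ?thesis
      using that by (simp add: ln_div algebra_simps)
  qed
  show ?thesis
    using ln_less[of a b] ln_less[of "1 - a" "1 - b"] assms by simp
qed

lemma honest_prob_eq_weighted_mean:
  "honest_prob T q p N 1 c =
    (\<Sum>\<theta>\<in>T. q \<theta> * p \<theta> ^ c * (1 - p \<theta>) ^ (N - 1 - c) * p \<theta>) /
    (\<Sum>\<theta>\<in>T. q \<theta> * p \<theta> ^ c * (1 - p \<theta>) ^ (N - 1 - c))"
  by (simp add: honest_prob_def mult_ac)

lemma honest_prob_0: "honest_prob T q p N 0 c = 1 - honest_prob T q p N 1 c"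
  by (simp add: honest_prob_def)

lemma honest_prob_1_bounds:
  assumes "finite T" "T \<noteq> {}" "\<And>\<theta>. \<theta> \<in> T \<Longrightarrow> q \<theta> > 0"
    and "\<And>\<theta>. \<theta> \<in> T \<Longrightarrow> 0 < p \<theta> \<and> p \<theta> < 1"
  shows "0 < honest_prob T q p N 1 c" "honest_prob T q p N 1 c < 1"
proof -
  have "honest_prob T q p N 1 c \<in> {0<..<1}"
    unfolding honest_prob_eq_weighted_mean
    using assms by (intro weighted_mean_in_convex) auto
  then show "0 < honest_prob T q p N 1 c" "honest_prob T q p N 1 c < 1"
    by auto
qed

lemma strict_mono_on_odds_power:
  assumes "k > 0"
  shows "strict_mono_on {0<..<1} (\<lambda>x::real. (x / (1 - x)) ^ k)"
  using assms by (intro strict_mono_onI power_strict_mono frac_less) auto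

lemma honest_prob_1_less:
  assumes "finite T" "\<And>\<theta>. \<theta> \<in> T \<Longrightarrow> q \<theta> > 0"
    and p: "\<And>\<theta>. \<theta> \<in> T \<Longrightarrow> 0 < p \<theta> \<and> p \<theta> < 1"
    and "a \<in> T" "b \<in> T" "p a \<noteq> p b" and "c < r" "r \<le> N - 1"
  shows "honest_prob T q p N 1 c < honest_prob T q p N 1 r"
proof -
  let ?w = "\<lambda>c \<theta>. q \<theta> * p \<theta> ^ c * (1 - p \<theta>) ^ (N - 1 - c)"
  let ?g = "\<lambda>x::real. (x / (1 - x)) ^ (r - c)"
  have w: "?w r \<theta> = ?w c \<theta> * ?g (p \<theta>)" if "\<theta> \<in> T" for \<theta>
  proof -
    \<comment> \<open>Subtraction truncates, so this uses \<open>c < r\<close> and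
      \<open>r \<le> N - 1\<close>.\<close>
    have "N - 1 - c = N - 1 - r + (r - c)" "r = c + (r - c)"
      using assms by auto
    then have "p \<theta> ^ r = p \<theta> ^ c * p \<theta> ^ (r - c)"
      "(1 - p \<theta>) ^ (N - 1 - c) = (1 - p \<theta>) ^ (N - 1 - r) * (1 - p \<theta>) ^ (r - c)"
      by (metis power_add)+
    then show ?thesis
      using p[OF that] by (simp add: power_divide)
  qed
  have "honest_prob T q p N 1 r =
      (\<Sum>\<theta>\<in>T. ?w c \<theta> * ?g (p \<theta>) * p \<theta>) / (\<Sum>\<theta>\<in>T. ?w c \<theta> * ?g (p \<theta>))"
    unfolding honest_prob_eq_weighted_mean
    by (intro arg_cong2[where f = "(/)"] sum.cong refl) (simp_all only: w)
  moreover have "honest_prob T q p N 1 c < \<dots>"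
    unfolding honest_prob_eq_weighted_mean
    using assms
    by (intro weighted_mean_strict_mono[where S = "{0<..<1}"] strict_mono_on_odds_power) auto
  ultimately show ?thesis by simp
qed

lemma proper_scoring_rule_ln:
  assumes "finite T" "\<And>\<theta>. \<theta> \<in> T \<Longrightarrow> q \<theta> > 0"
    and "\<And>\<theta>. \<theta> \<in> T \<Longrightarrow> 0 < p \<theta> \<and> p \<theta> < 1"
    and "a \<in> T" "b \<in> T" "p a \<noteq> p b"
  shows "proper_scoring_rule T q p N (\<lambda>i j. ln (honest_prob T q p N i j))"
  unfolding proper_scoring_rule_def honest_prob_0
proof (intro ballI impI)
  fix c r assume cr: "c \<in> {0..N - 1}" "r \<in> {0..N - 1}" "c \<noteq> r"
  have "T \<noteq> {}" using assms by auto
  note bounds = honest_prob_1_bounds[OF assms(1) this assms(2,3)]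
  have less: "honest_prob T q p N 1 i < honest_prob T q p N 1 j" if "i < j" "j \<le> N - 1" for i j
    using assms that by (intro honest_prob_1_less[of T q p a b]) auto
  \<comment> \<open>Strict monotonicity, applied in whichever order \<open>c\<close> and
    \<open>r\<close> stand.\<close>
  have "honest_prob T q p N 1 c \<noteq> honest_prob T q p N 1 r"
    using less[of c r] less[of r c] cr by (cases c r rule: linorder_cases) auto
  with bounds show "(1 - honest_prob T q p N 1 c) * ln (1 - honest_prob T q p N 1 r) +
        honest_prob T q p N 1 c * ln (honest_prob T q p N 1 r)
      < (1 - honest_prob T q p N 1 c) * ln (1 - honest_prob T q p N 1 c) +
        honest_prob T q p N 1 c * ln (honest_prob T q p N 1 c)"
    by (intro gibbs_binary) auto
qed

text \<open>The identity holds for each honest report separately. Report 0 pairs the two payments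
  with \<open>k = r - 1\<close>, report 1 those with \<open>k = r\<close>; the foreign scores cancel
  and \<open>N - 1\<close> copies of the wanted one remain. The extremes \<open>r = 0\<close> and
  \<open>r = N - 1\<close> use the two separate formulas.\<close>

lemma agent_payoff_eq_expected_score:
  fixes SR \<tau> :: "nat \<Rightarrow> nat \<Rightarrow> real"
  assumes "N \<ge> 2" "r \<le> N - 1"
    and \<tau>00: "\<tau> 0 0 = SR 0 0 / real (N - 1)"
    and \<tau>1N: "\<tau> 1 (N - 1) = SR 1 (N - 1) / real (N - 1)"
    and \<tau>0: "\<And>k. k \<le> N - 2 \<Longrightarrow>
      \<tau> 0 (k + 1) = (real (k + 1) * SR 1 k - real k * SR 0 (k + 1)) / real (N - 1)"
    and \<tau>1: "\<And>k. k \<le> N - 2 \<Longrightarrow>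
      \<tau> 1 k = (real (N - 1 - k) * SR 0 (k + 1) - real (N - 2 - k) * SR 1 k) / real (N - 1)"
  shows "agent_payoff T q p N \<tau> r c =
    honest_prob T q p N 0 c * SR 0 r + honest_prob T q p N 1 c * SR 1 r"
proof -
  have N: "real (N - 1) > 0" using assms by simp
  have "real r * \<tau> 1 (r - 1) + real (N - 1 - r) * \<tau> 0 r = SR 0 r"
  proof (cases r)
    case 0
    then show ?thesis using N \<tau>00 by simp
  next
    case (Suc k)
    \<comment> \<open>\<open>l\<close> is the number of negative reports; writing \<open>N\<close>
      through \<open>k\<close> and \<open>l\<close> eliminates truncated subtraction.\<close>
    define l where "l = N - 2 - k"
    have l: "N = Suc (Suc (k + l))"
      using assms(1,2) Suc by (simp add: l_def)
    have "real r * \<tau> 1 (r - 1) + real (N - 1 - r) * \<tau> 0 r =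
        (real (k + 1) * (real (l + 1) * SR 0 (k + 1) - real l * SR 1 k) +
         real l * (real (k + 1) * SR 1 k - real k * SR 0 (k + 1))) / real (N - 1)"
      using \<tau>0[of k] \<tau>1[of k] by (simp add: Suc l add_divide_distrib)
    also have "\<dots> = real (N - 1) * SR 0 r / real (N - 1)"
      by (rule arg_cong[where f = "\<lambda>x. x / _"]) (simp add: Suc l algebra_simps)
    finally show ?thesis using N by simp
  qed
  moreover have "real r * \<tau> 1 (r - 1 + 1) + real (N - 1 - r) * \<tau> 0 (r + 1) = SR 1 r"
  proof (cases "r = N - 1")
    case True
    \<comment> \<open>No negative reports are left, so the out-of-range index \<open>N\<close> has
      coefficient 0.\<close>
    then have "r - 1 + 1 = N - 1" using assms(1) by simp
    with True show ?thesis using N \<tau>1N by simp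
  next
    case False
    define l where "l = N - 2 - r"
    have l: "N = Suc (Suc (r + l))"
      using assms(1,2) False by (simp add: l_def)
    \<comment> \<open>At \<open>r = 0\<close> the indices differ, but the coefficient is 0.\<close>
    have shift: "real r * \<tau> 1 (r - 1 + 1) = real r * \<tau> 1 r"
      by (cases r) auto
    have "real r * \<tau> 1 (r - 1 + 1) + real (N - 1 - r) * \<tau> 0 (r + 1) =
        (real r * (real (l + 1) * SR 0 (r + 1) - real l * SR 1 r) +
         real (l + 1) * (real (r + 1) * SR 1 r - real r * SR 0 (r + 1))) / real (N - 1)"
      unfolding shift using \<tau>0[of r] \<tau>1[of r] by (simp add: l add_divide_distrib)
    also have "\<dots> = real (N - 1) * SR 1 r / real (N - 1)"
      by (rule arg_cong[where f = "\<lambda>x. x / _"]) (simp add: l algebra_simps)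
    finally show ?thesis using N by simp
  qed
  ultimately show ?thesis
    by (simp add: agent_payoff_def)
qed

theorem proposition4p8:
  fixes T :: "'a set" and q p :: "'a \<Rightarrow> real" and N :: nat
  assumes "finite T" and "card T \<ge> 2"
    and "\<And>\<theta>. \<theta> \<in> T \<Longrightarrow> q \<theta> > 0" and "(\<Sum>\<theta>\<in>T. q \<theta>) = 1"
    and "\<And>\<theta>. \<theta> \<in> T \<Longrightarrow> 0 < p \<theta> \<and> p \<theta> < 1" and "inj_on p T"
    and "N \<ge> 2"
  shows "(\<forall>(SR :: nat \<Rightarrow> nat \<Rightarrow> real) (\<tau> :: nat \<Rightarrow> nat \<Rightarrow> real).
            proper_scoring_rule T q p N SR \<and>
            \<tau> 0 0 = SR 0 0 / real (N - 1) \<and>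
            \<tau> 1 (N - 1) = SR 1 (N - 1) / real (N - 1) \<and>
            (\<forall>k\<in>{0..N - 2}.
               \<tau> 0 (k + 1) = (real (k + 1) * SR 1 k - real k * SR 0 (k + 1)) / real (N - 1) \<and>
               \<tau> 1 k = (real (N - 1 - k) * SR 0 (k + 1) - real (N - 2 - k) * SR 1 k) / real (N - 1))
            \<longrightarrow> encourages_honesty T q p N \<tau>) \<and>
         proper_scoring_rule T q p N (\<lambda>i j. ln (honest_prob T q p N i j))"
proof (intro conjI allI impI; (elim conjE)?)
  fix SR \<tau> :: "nat \<Rightarrow> nat \<Rightarrow> real"
  assume proper: "proper_scoring_rule T q p N SR"
    and \<tau>: "\<tau> 0 0 = SR 0 0 / real (N - 1)" "\<tau> 1 (N - 1) = SR 1 (N - 1) / real (N - 1)"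
    "\<forall>k\<in>{0..N - 2}.
       \<tau> 0 (k + 1) = (real (k + 1) * SR 1 k - real k * SR 0 (k + 1)) / real (N - 1) \<and>
       \<tau> 1 k = (real (N - 1 - k) * SR 0 (k + 1) - real (N - 2 - k) * SR 1 k) / real (N - 1)"
  have payoff: "agent_payoff T q p N \<tau> r c =
      honest_prob T q p N 0 c * SR 0 r + honest_prob T q p N 1 c * SR 1 r" if "r \<le> N - 1" for r c
    using \<tau>(3) by (intro agent_payoff_eq_expected_score[OF \<open>N \<ge> 2\<close> that \<tau>(1,2)]) auto
  show "encourages_honesty T q p N \<tau>"
    using proper unfolding encourages_honesty_def proper_scoring_rule_def
    by (auto simp: payoff)
next
  \<comment> \<open>Two types with distinct signal probabilities are what makes the posterior vary
    with the count.\<close>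
  obtain a b where "a \<in> T" "b \<in> T" "a \<noteq> b"
    using \<open>card T \<ge> 2\<close> card_le_Suc0_iff_eq[OF \<open>finite T\<close>] by force
  with \<open>inj_on p T\<close> have "p a \<noteq> p b"
    by (auto dest: inj_onD)
  then show "proper_scoring_rule T q p N (\<lambda>i j. ln (honest_prob T q p N i j))"
    using assms \<open>a \<in> T\<close> \<open>b \<in> T\<close> by (intro proper_scoring_rule_ln[of T q p a b]) auto
qed

end
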